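(* Let $(H,\langle\!\langle\cdot,\cdot\rangle\!\rangle,\nabla^+,\nabla^-,\Psi)$ be a Legendre bundle over a smooth manifold $B$, with $H=H^+\oplus H^-$. Define $J:H\to H$ by $J|_{H^+}=+\mathrm{id}$ and $J|_{H^-}=-\mathrm{id}$, and define $\boldsymbol{\omega}^S(X,Y)=\langle\!\langle JX,Y\rangle\!\rangle$. Then $(H,J,\boldsymbol{\omega}^S)$, with the connection $\nabla=\nabla^+\oplus\nabla^-$ on $H$, is a para-Kähler vector bundle over $B$.
   Context: Legendre bundle over $B$: a quintuple $(H,\langle\!\langle\cdot,\cdot\rangle\!\rangle,\nabla^+,\nabla^-,\Psi)$ where: (1) $H=H^+\oplus H^-$ is a vector bundle over $B$ with isomorphisms $H^+\cong TB$, $H^-\cong T^*B$; (2) $\langle\!\langle\cdot,\cdot\rangle\!\rangle$ is a non-degenerate symmetric bilinear form on $H$ vanishing on $H^+\otimes H^+$ and on $H^-\otimes H^-$, with $\langle\!\langle X,\alpha\rangle\!\rangle=\alpha(X)$ for $X\in H^+$, $\alpha\in H^-$; (3) $\nabla^+$ and $\nabla^-$ are flat connections on $H^+$ and $H^-$ satisfying $Z\langle\!\langle X,\alpha\rangle\!\rangle=\langle\!\langle\nabla^+_ZX,\alpha\rangle\!\rangle+\langle\!\langle X,\nabla^-_Z\alpha\rangle\!\rangle$ for all sections $X$ of $H^+$, $\alpha$ of $H^-$ and all vector fields $Z$ on $B$; here $\nabla^+$, viewed on $TB$, is torsion-free, so that local $\nabla^+$-flat coordinates $(\theta^i)$ (with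 $\partial_i$ parallel) exist; (4) $\Psi\in C^\infty(B)$ is strictly convex with respect to the flat structure of $\nabla^+$ (positive-definite Hessian in $\nabla^+$-flat coordinates), with associated Legendre morphism $\mathscr{L}_\Psi:H^+\to H^-$, $\mathscr{L}_\Psi(\partial_j)=\sum_i(\partial_i\partial_j\Psi)\,d\theta^i$. Para-Kähler vector bundle over $B$: a quadruple $(H,J,\boldsymbol{\omega}^S,\nabla)$ where $H$ is a real vector bundle over $B$; $J$ is a vector bundle endomorphism of $H$ with $J^2=\mathrm{id}_H$ such that $\ker(J-\mathrm{id}_H)$ and $\ker(J+\mathrm{id}_H)$ have equal rank; $\boldsymbol{\omega}^S$ is a non-degenerate skew-symmetric bilinear form on the fibres of $H$ with $\boldsymbol{\omega}^S(JX,JY)=-\boldsymbol{\omega}^S(X,Y)$ for all $X,Y$; and $\nabla$ is a flat connection on $H$ with $\nabla J=0$ and $\nabla\boldsymbol{\omega}^S=0$. *)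

theory Defs
  imports "HOL-Analysis.Analysis" "HOL-Library.Function_Algebras"
begin

text \<open>Tangent and cotangent vectors below are functions, so the pointwise vector space
  structure on function types is needed.\<close>

instantiation "fun" :: (type, real_vector) real_vector
begin

definition scaleR_fun :: "real \<Rightarrow> ('a \<Rightarrow> 'b) \<Rightarrow> 'a \<Rightarrow> 'b" where
  "scaleR_fun c f = (\<lambda>x. c *\<^sub>R f x)"

instance
  by standard (auto simp: scaleR_fun_def fun_eq_iff scaleR_add_right scaleR_add_left)

end

lemma scaleR_fun_apply [simp]: "(c *\<^sub>R f) x = c *\<^sub>R f x"
  by (simp add: scaleR_fun_def)


section \<open>Smooth manifolds\<close>

text \<open>\<open>Ck_on k S f\<close> is meant for open \<open>S\<close> and finite-dimensional domain: all iterated directional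
  derivatives of order up to \<open>k\<close> exist (as Frechet derivatives) and are continuous.\<close>

fun Ck_on :: "nat \<Rightarrow> 'a::real_normed_vector set \<Rightarrow> ('a \<Rightarrow> 'c::real_normed_vector) \<Rightarrow> bool" where
  "Ck_on 0 S f \<longleftrightarrow> continuous_on S f"
| "Ck_on (Suc k) S f \<longleftrightarrow> (\<forall>x\<in>S. f differentiable (at x)) \<and>
     (\<forall>v. Ck_on k S (\<lambda>x. frechet_derivative f (at x) v))"

definition smooth_on :: "'a::real_normed_vector set \<Rightarrow> ('a \<Rightarrow> 'c::real_normed_vector) \<Rightarrow> bool" where
  "smooth_on S f \<longleftrightarrow> (\<forall>k. Ck_on k S f)"

text \<open>A chart \<open>(U, \<theta>)\<close> is a domain together with a coordinate map; \<open>\<theta>\<close> is irrelevant outside \<open>U\<close>.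
  The manifold is the whole type \<open>'b\<close>, of dimension \<open>CARD('n)\<close>.\<close>

type_synonym ('b, 'n) chart = "'b set \<times> ('b \<Rightarrow> real^'n)"
type_synonym ('b, 'n) atlas = "('b, 'n) chart set"

definition chart :: "('b::topological_space, 'n::finite) chart \<Rightarrow> bool" where
  "chart c \<longleftrightarrow> (case c of (U, \<theta>) \<Rightarrow>
     open U \<and> open (\<theta> ` U) \<and> homeomorphism U (\<theta> ` U) \<theta> (inv_into U \<theta>))"

definition smoothly_compatible ::
    "('b::topological_space, 'n::finite) chart \<Rightarrow> ('b, 'n) chart \<Rightarrow> bool" where
  "smoothly_compatible c d \<longleftrightarrow> (case (c, d) of ((U, \<theta>), (V, \<eta>)) \<Rightarrow>
     smooth_on (\<theta> ` (U \<inter> V)) (\<eta> \<circ> inv_into U \<theta>) \<and>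
     smooth_on (\<eta> ` (U \<inter> V)) (\<theta> \<circ> inv_into V \<eta>))"

definition smooth_manifold ::
    "('b::{t2_space,second_countable_topology}, 'n::finite) atlas \<Rightarrow> bool" where
  "smooth_manifold A \<longleftrightarrow>
     (\<forall>c\<in>A. chart c) \<and> (\<Union>(U, \<theta>)\<in>A. U) = UNIV \<and> (\<forall>c\<in>A. \<forall>d\<in>A. smoothly_compatible c d)"

text \<open>Membership in the maximal atlas generated by \<open>A\<close>.\<close>

definition smooth_chart :: "('b::topological_space, 'n::finite) atlas \<Rightarrow> ('b, 'n) chart \<Rightarrow> bool" where
  "smooth_chart A c \<longleftrightarrow> chart c \<and> (\<forall>d\<in>A. smoothly_compatible c d)"

definition smooth_fun :: "('b::topological_space, 'n::finite) atlas \<Rightarrow> 'b set \<Rightarrow>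
    ('b \<Rightarrow> 'c::real_normed_vector) \<Rightarrow> bool" where
  "smooth_fun A U f \<longleftrightarrow> (\<forall>(V, \<theta>)\<in>A. smooth_on (\<theta> ` (U \<inter> V)) (f \<circ> inv_into V \<theta>))"

definition smooth_near :: "('b::topological_space, 'n::finite) atlas \<Rightarrow> 'b \<Rightarrow> ('b \<Rightarrow> real) \<Rightarrow> bool" where
  "smooth_near A p f \<longleftrightarrow> (\<exists>U. open U \<and> p \<in> U \<and> smooth_fun A U f)"


section \<open>Vector bundles\<close>

text \<open>The fibres are subspaces of an arbitrary real vector space \<open>'v\<close>. This is no restriction: any
  family of vector spaces embeds fibrewise into its direct sum. The type \<open>'v\<close> carries no topology;
  the smooth structure of the bundle is given by the local trivialisations \<open>(U, \<Phi>)\<close>, where \<open>\<Phi> p\<close>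
  maps the fibre over \<open>p \<in> U\<close> isomorphically onto the model fibre \<open>'f\<close>.\<close>

record ('b, 'v, 'f) vbundle =
  fib :: "'b \<Rightarrow> 'v set"
  trivs :: "('b set \<times> ('b \<Rightarrow> 'v \<Rightarrow> 'f)) set"

definition linear_from :: "'v::real_vector set \<Rightarrow> ('v \<Rightarrow> 'w::real_vector) \<Rightarrow> bool" where
  "linear_from V f \<longleftrightarrow>
     (\<forall>x\<in>V. \<forall>y\<in>V. f (x + y) = f x + f y) \<and> (\<forall>c. \<forall>x\<in>V. f (c *\<^sub>R x) = c *\<^sub>R f x)"

definition vector_bundle :: "('b::topological_space, 'n::finite) atlas \<Rightarrow>
    ('b, 'v::real_vector, 'f::euclidean_space) vbundle \<Rightarrow> bool" where
  "vector_bundle A E \<longleftrightarrow>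
     (\<forall>p. subspace (fib E p)) \<and>
     (\<Union>(U, \<Phi>)\<in>trivs E. U) = UNIV \<and>
     (\<forall>(U, \<Phi>)\<in>trivs E. open U \<and>
        (\<forall>p\<in>U. linear_from (fib E p) (\<Phi> p) \<and> bij_betw (\<Phi> p) (fib E p) UNIV)) \<and>
     (\<forall>(U, \<Phi>)\<in>trivs E. \<forall>(V, \<Phi>')\<in>trivs E. \<forall>w.
        smooth_fun A (U \<inter> V) (\<lambda>p. \<Phi>' p (inv_into (fib E p) (\<Phi> p) w)))"

text \<open>Smooth sections over an open set \<open>U\<close>; their values outside \<open>U\<close> are irrelevant.\<close>

definition sections :: "('b::topological_space, 'n::finite) atlas \<Rightarrow>
    ('b, 'v::real_vector, 'f::euclidean_space) vbundle \<Rightarrow> 'b set \<Rightarrow> ('b \<Rightarrow> 'v) set" where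
  "sections A E U = {s. (\<forall>p\<in>U. s p \<in> fib E p) \<and>
     (\<forall>(V, \<Phi>)\<in>trivs E. smooth_fun A (U \<inter> V) (\<lambda>p. \<Phi> p (s p)))}"

text \<open>Smooth bundle morphisms over the identity: smoothness of a fibrewise linear map is the
  preservation of smooth local sections.\<close>

definition bundle_morphism :: "('b::topological_space, 'n::finite) atlas \<Rightarrow>
    ('b, 'v::real_vector, 'f::euclidean_space) vbundle \<Rightarrow>
    ('b, 'w::real_vector, 'g::euclidean_space) vbundle \<Rightarrow> ('b \<Rightarrow> 'v \<Rightarrow> 'w) \<Rightarrow> bool" where
  "bundle_morphism A E F \<phi> \<longleftrightarrow>
     (\<forall>p. linear_from (fib E p) (\<phi> p) \<and> \<phi> p ` fib E p \<subseteq> fib F p) \<and>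
     (\<forall>U. open U \<longrightarrow> (\<forall>s\<in>sections A E U. (\<lambda>p. \<phi> p (s p)) \<in> sections A F U))"

definition bundle_isomorphism :: "('b::topological_space, 'n::finite) atlas \<Rightarrow>
    ('b, 'v::real_vector, 'f::euclidean_space) vbundle \<Rightarrow>
    ('b, 'w::real_vector, 'g::euclidean_space) vbundle \<Rightarrow> ('b \<Rightarrow> 'v \<Rightarrow> 'w) \<Rightarrow> bool" where
  "bundle_isomorphism A E F \<phi> \<longleftrightarrow>
     (\<forall>p. bij_betw (\<phi> p) (fib E p) (fib F p)) \<and>
     bundle_morphism A E F \<phi> \<and> bundle_morphism A F E (\<lambda>p. inv_into (fib E p) (\<phi> p))"

definition bilinear_bundle_form :: "('b::topological_space, 'n::finite) atlas \<Rightarrow>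
    ('b, 'v::real_vector, 'f::euclidean_space) vbundle \<Rightarrow> ('b \<Rightarrow> 'v \<Rightarrow> 'v \<Rightarrow> real) \<Rightarrow> bool" where
  "bilinear_bundle_form A E g \<longleftrightarrow>
     (\<forall>p. \<forall>x\<in>fib E p. linear_from (fib E p) (g p x) \<and> linear_from (fib E p) (\<lambda>y. g p y x)) \<and>
     (\<forall>U. open U \<longrightarrow> (\<forall>s\<in>sections A E U. \<forall>t\<in>sections A E U.
        smooth_fun A U (\<lambda>p. g p (s p) (t p))))"

definition nondegenerate :: "('b, 'v::real_vector, 'f) vbundle \<Rightarrow> ('b \<Rightarrow> 'v \<Rightarrow> 'v \<Rightarrow> real) \<Rightarrow> bool" where
  "nondegenerate E g \<longleftrightarrow> (\<forall>p. \<forall>x\<in>fib E p. (\<forall>y\<in>fib E p. g p x y = 0) \<longrightarrow> x = 0)"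

text \<open>Internal direct sum of vector bundles. The last clause says that the smooth structure of \<open>E\<close> is
  that of the Whitney sum.\<close>

definition direct_sum_bundle :: "('b::topological_space, 'n::finite) atlas \<Rightarrow>
    ('b, 'v::real_vector, 'f::euclidean_space) vbundle \<Rightarrow>
    ('b, 'v, 'g::euclidean_space) vbundle \<Rightarrow> ('b, 'v, 'h::euclidean_space) vbundle \<Rightarrow> bool" where
  "direct_sum_bundle A E F G \<longleftrightarrow>
     (\<forall>p. fib F p \<inter> fib G p = {0} \<and> fib E p = {x + y | x y. x \<in> fib F p \<and> y \<in> fib G p}) \<and>
     (\<forall>U s t. open U \<longrightarrow> (\<forall>p\<in>U. s p \<in> fib F p \<and> t p \<in> fib G p) \<longrightarrow>
        ((\<lambda>p. s p + t p) \<in> sections A E U \<longleftrightarrow> s \<in> sections A F U \<and> t \<in> sections A G U))"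


section \<open>Tangent and cotangent bundle\<close>

text \<open>A tangent vector at \<open>p\<close> is a derivation of the algebra of germs at \<open>p\<close> of smooth functions,
  extended by \<open>0\<close> to all functions that are not smooth near \<open>p\<close>.\<close>

type_synonym 'b tangent = "('b \<Rightarrow> real) \<Rightarrow> real"

definition tangent_space :: "('b::topological_space, 'n::finite) atlas \<Rightarrow> 'b \<Rightarrow> 'b tangent set" where
  "tangent_space A p = {v.
     (\<forall>f h. smooth_near A p f \<longrightarrow> smooth_near A p h \<longrightarrow>
        v (\<lambda>q. f q + h q) = v f + v h \<and>
        v (\<lambda>q. f q * h q) = f p * v h + h p * v f) \<and>
     (\<forall>c f. smooth_near A p f \<longrightarrow> v (\<lambda>q. c * f q) = c * v f) \<and>
     (\<forall>f h. smooth_near A p f \<longrightarrow> smooth_near A p h \<longrightarrow>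
        (\<exists>U. open U \<and> p \<in> U \<and> (\<forall>q\<in>U. f q = h q)) \<longrightarrow> v f = v h) \<and>
     (\<forall>f. \<not> smooth_near A p f \<longrightarrow> v f = 0)}"

text \<open>The coordinate vector \<open>\<partial>\<^sub>i\<close> of the chart \<open>(U, \<theta>)\<close> at \<open>p \<in> U\<close>.\<close>

definition coord_vec :: "('b::topological_space, 'n::finite) atlas \<Rightarrow> ('b, 'n) chart \<Rightarrow> 'n \<Rightarrow>
    'b \<Rightarrow> 'b tangent" where
  "coord_vec A c i p f = (case c of (U, \<theta>) \<Rightarrow>
     if smooth_near A p f
     then frechet_derivative (f \<circ> inv_into U \<theta>) (at (\<theta> p)) (axis i 1) else 0)"

text \<open>The local trivialisation of the tangent bundle given by a chart sends \<open>v\<close> to its components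
  \<open>v(\<theta>\<^sup>i)\<close>, that of the cotangent bundle sends \<open>\<alpha>\<close> to its components \<open>\<alpha>(\<partial>\<^sub>i)\<close>.\<close>

definition tangent_bundle :: "('b::topological_space, 'n::finite) atlas \<Rightarrow>
    ('b, 'b tangent, real^'n) vbundle" where
  "tangent_bundle A =
     \<lparr> fib = tangent_space A,
       trivs = (\<lambda>(U, \<theta>). (U, \<lambda>p v. \<chi> i. v (\<lambda>q. \<theta> q $ i))) ` A \<rparr>"

definition cotangent_bundle :: "('b::topological_space, 'n::finite) atlas \<Rightarrow>
    ('b, 'b tangent \<Rightarrow> real, real^'n) vbundle" where
  "cotangent_bundle A =
     \<lparr> fib = (\<lambda>p. {\<alpha>. linear_from (tangent_space A p) \<alpha> \<and> (\<forall>v. v \<notin> tangent_space A p \<longrightarrow> \<alpha> v = 0)}),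
       trivs = (\<lambda>c. (fst c, \<lambda>p \<alpha>. \<chi> i. \<alpha> (coord_vec A c i p))) ` A \<rparr>"

abbreviation vector_fields :: "('b::topological_space, 'n::finite) atlas \<Rightarrow> ('b \<Rightarrow> 'b tangent) set" where
  "vector_fields A \<equiv> sections A (tangent_bundle A) UNIV"

text \<open>The guard makes the value a tangent vector in the above sense: \<open>q \<mapsto> Y q f\<close> can be smooth near \<open>p\<close>
  although \<open>f\<close> is not.\<close>

definition lie_bracket :: "('b::topological_space, 'n::finite) atlas \<Rightarrow>
    ('b \<Rightarrow> 'b tangent) \<Rightarrow> ('b \<Rightarrow> 'b tangent) \<Rightarrow> 'b \<Rightarrow> 'b tangent" where
  "lie_bracket A X Y p f =
     (if smooth_near A p f then X p (\<lambda>q. Y q f) - Y p (\<lambda>q. X q f) else 0)"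


section \<open>Connections\<close>

text \<open>\<open>D Z s\<close> is the covariant derivative of the section \<open>s\<close> along the vector field \<open>Z\<close>.\<close>

type_synonym ('b, 'v) conn = "('b \<Rightarrow> 'b tangent) \<Rightarrow> ('b \<Rightarrow> 'v) \<Rightarrow> 'b \<Rightarrow> 'v"

definition connection :: "('b::topological_space, 'n::finite) atlas \<Rightarrow>
    ('b, 'v::real_vector, 'f::euclidean_space) vbundle \<Rightarrow> ('b, 'v) conn \<Rightarrow> bool" where
  "connection A E D \<longleftrightarrow>
     (\<forall>Z\<in>vector_fields A. \<forall>s\<in>sections A E UNIV. D Z s \<in> sections A E UNIV) \<and>
     (\<forall>Y\<in>vector_fields A. \<forall>Z\<in>vector_fields A. \<forall>s\<in>sections A E UNIV.
        D (\<lambda>p. Y p + Z p) s = (\<lambda>p. D Y s p + D Z s p)) \<and>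
     (\<forall>Z\<in>vector_fields A. \<forall>s\<in>sections A E UNIV. \<forall>t\<in>sections A E UNIV.
        D Z (\<lambda>p. s p + t p) = (\<lambda>p. D Z s p + D Z t p)) \<and>
     (\<forall>f Z s. smooth_fun A UNIV f \<longrightarrow> Z \<in> vector_fields A \<longrightarrow> s \<in> sections A E UNIV \<longrightarrow>
        D (\<lambda>p. f p *\<^sub>R Z p) s = (\<lambda>p. f p *\<^sub>R D Z s p) \<and>
        D Z (\<lambda>p. f p *\<^sub>R s p) = (\<lambda>p. Z p f *\<^sub>R s p + f p *\<^sub>R D Z s p))"

definition curvature :: "('b::topological_space, 'n::finite) atlas \<Rightarrow> ('b, 'v::real_vector) conn \<Rightarrow>
    ('b \<Rightarrow> 'b tangent) \<Rightarrow> ('b \<Rightarrow> 'b tangent) \<Rightarrow> ('b \<Rightarrow> 'v) \<Rightarrow> 'b \<Rightarrow> 'v" where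
  "curvature A D X Y s p = D X (D Y s) p - D Y (D X s) p - D (lie_bracket A X Y) s p"

definition flat_connection :: "('b::topological_space, 'n::finite) atlas \<Rightarrow>
    ('b, 'v::real_vector, 'f::euclidean_space) vbundle \<Rightarrow> ('b, 'v) conn \<Rightarrow> bool" where
  "flat_connection A E D \<longleftrightarrow> connection A E D \<and>
     (\<forall>X\<in>vector_fields A. \<forall>Y\<in>vector_fields A. \<forall>s\<in>sections A E UNIV. \<forall>p. curvature A D X Y s p = 0)"

definition cov_deriv_end :: "('b, 'v::real_vector) conn \<Rightarrow> ('b \<Rightarrow> 'v \<Rightarrow> 'v) \<Rightarrow>
    ('b \<Rightarrow> 'b tangent) \<Rightarrow> ('b \<Rightarrow> 'v) \<Rightarrow> 'b \<Rightarrow> 'v" where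
  "cov_deriv_end D J Z s p = D Z (\<lambda>q. J q (s q)) p - J p (D Z s p)"

definition cov_deriv_form :: "('b, 'v::real_vector) conn \<Rightarrow> ('b \<Rightarrow> 'v \<Rightarrow> 'v \<Rightarrow> real) \<Rightarrow>
    ('b \<Rightarrow> 'b tangent) \<Rightarrow> ('b \<Rightarrow> 'v) \<Rightarrow> ('b \<Rightarrow> 'v) \<Rightarrow> 'b \<Rightarrow> real" where
  "cov_deriv_form D g Z s t p =
     Z p (\<lambda>q. g q (s q) (t q)) - g p (D Z s p) (t p) - g p (s p) (D Z t p)"

text \<open>The connection on the tangent bundle corresponding to a connection on \<open>E\<close> under an isomorphism
  \<open>\<tau>\<close> from \<open>E\<close> to the tangent bundle.\<close>

definition tangent_connection :: "('b, 'v::real_vector, 'f) vbundle \<Rightarrow> ('b \<Rightarrow> 'v \<Rightarrow> 'b tangent) \<Rightarrow>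
    ('b, 'v) conn \<Rightarrow> ('b, 'b tangent) conn" where
  "tangent_connection E \<tau> D Z Y p = \<tau> p (D Z (\<lambda>q. inv_into (fib E q) (\<tau> q) (Y q)) p)"

definition torsion_free :: "('b::topological_space, 'n::finite) atlas \<Rightarrow> ('b, 'b tangent) conn \<Rightarrow> bool" where
  "torsion_free A D \<longleftrightarrow> (\<forall>X\<in>vector_fields A. \<forall>Y\<in>vector_fields A. \<forall>p.
     D X Y p - D Y X p = lie_bracket A X Y p)"

text \<open>A connection acts on global sections. A local section \<open>s\<close> over \<open>U\<close> is parallel if the covariant
  derivative of every global section that agrees with \<open>s\<close> on some open \<open>V \<subseteq> U\<close> vanishes on \<open>V\<close>; such
  global sections exist near every point of \<open>U\<close> by means of bump functions.\<close>

definition parallel_on :: "('b::topological_space, 'n::finite) atlas \<Rightarrow>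
    ('b, 'v::real_vector, 'f::euclidean_space) vbundle \<Rightarrow> ('b, 'v) conn \<Rightarrow> 'b set \<Rightarrow> ('b \<Rightarrow> 'v) \<Rightarrow> bool" where
  "parallel_on A E D U s \<longleftrightarrow>
     (\<forall>V. open V \<longrightarrow> V \<subseteq> U \<longrightarrow> (\<forall>t\<in>sections A E UNIV. (\<forall>p\<in>V. t p = s p) \<longrightarrow>
        (\<forall>Z\<in>vector_fields A. \<forall>p\<in>V. D Z t p = 0)))"

definition flat_chart :: "('b::topological_space, 'n::finite) atlas \<Rightarrow> ('b, 'b tangent) conn \<Rightarrow>
    ('b, 'n) chart \<Rightarrow> bool" where
  "flat_chart A D c \<longleftrightarrow> smooth_chart A c \<and>
     (\<forall>i. parallel_on A (tangent_bundle A) D (fst c) (coord_vec A c i))"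

definition coord_hessian :: "('b::topological_space, 'n::finite) atlas \<Rightarrow> ('b, 'n) chart \<Rightarrow>
    ('b \<Rightarrow> real) \<Rightarrow> 'b \<Rightarrow> real^'n^'n" where
  "coord_hessian A c \<psi> p = (\<chi> i j. coord_vec A c i p (\<lambda>q. coord_vec A c j q \<psi>))"

definition strictly_convex_wrt :: "('b::topological_space, 'n::finite) atlas \<Rightarrow>
    ('b, 'b tangent) conn \<Rightarrow> ('b \<Rightarrow> real) \<Rightarrow> bool" where
  "strictly_convex_wrt A D \<psi> \<longleftrightarrow> (\<forall>c. flat_chart A D c \<longrightarrow>
     (\<forall>p\<in>fst c. \<forall>w. w \<noteq> 0 \<longrightarrow> w \<bullet> (coord_hessian A c \<psi> p *v w) > 0))"


section \<open>Legendre bundles and para-Kaehler vector bundles\<close>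

text \<open>\<open>\<tau>p\<close> and \<open>\<tau>m\<close> are the identifications of \<open>Hp\<close> and \<open>Hm\<close> with the tangent and the cotangent
  bundle.\<close>

locale legendre_bundle =
  fixes A :: "('b::{t2_space,second_countable_topology}, 'n::finite) atlas"
    and H :: "('b, 'v::real_vector, 'f::euclidean_space) vbundle"
    and Hp :: "('b, 'v, 'g::euclidean_space) vbundle"
    and Hm :: "('b, 'v, 'h::euclidean_space) vbundle"
    and \<tau>p :: "'b \<Rightarrow> 'v \<Rightarrow> 'b tangent"
    and \<tau>m :: "'b \<Rightarrow> 'v \<Rightarrow> ('b tangent \<Rightarrow> real)"
    and g :: "'b \<Rightarrow> 'v \<Rightarrow> 'v \<Rightarrow> real"
    and Dp Dm :: "('b, 'v) conn"
    and \<Psi> :: "'b \<Rightarrow> real"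
  assumes manifold: "smooth_manifold A"
    and vector_bundle_H: "vector_bundle A H"
    and vector_bundle_p: "vector_bundle A Hp"
    and vector_bundle_m: "vector_bundle A Hm"
    and direct_sum: "direct_sum_bundle A H Hp Hm"
    and iso_p: "bundle_isomorphism A Hp (tangent_bundle A) \<tau>p"
    and iso_m: "bundle_isomorphism A Hm (cotangent_bundle A) \<tau>m"
    and form: "bilinear_bundle_form A H g"
    and form_nondegenerate: "nondegenerate H g"
    and form_sym: "\<And>p x y. x \<in> fib H p \<Longrightarrow> y \<in> fib H p \<Longrightarrow> g p x y = g p y x"
    and form_p: "\<And>p x y. x \<in> fib Hp p \<Longrightarrow> y \<in> fib Hp p \<Longrightarrow> g p x y = 0"
    and form_m: "\<And>p a b. a \<in> fib Hm p \<Longrightarrow> b \<in> fib Hm p \<Longrightarrow> g p a b = 0"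
    and form_pairing: "\<And>p x a. x \<in> fib Hp p \<Longrightarrow> a \<in> fib Hm p \<Longrightarrow> g p x a = \<tau>m p a (\<tau>p p x)"
    and flat_p: "flat_connection A Hp Dp"
    and flat_m: "flat_connection A Hm Dm"
    and duality: "\<And>Z X a p. Z \<in> vector_fields A \<Longrightarrow> X \<in> sections A Hp UNIV \<Longrightarrow>
      a \<in> sections A Hm UNIV \<Longrightarrow>
      Z p (\<lambda>q. g q (X q) (a q)) = g p (Dp Z X p) (a p) + g p (X p) (Dm Z a p)"
    and torsion: "torsion_free A (tangent_connection Hp \<tau>p Dp)"
    and potential_smooth: "smooth_fun A UNIV \<Psi>"
    and potential_convex: "strictly_convex_wrt A (tangent_connection Hp \<tau>p Dp) \<Psi>"

locale para_kaehler_bundle =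
  fixes A :: "('b::{t2_space,second_countable_topology}, 'n::finite) atlas"
    and H :: "('b, 'v::real_vector, 'f::euclidean_space) vbundle"
    and J :: "'b \<Rightarrow> 'v \<Rightarrow> 'v"
    and \<omega> :: "'b \<Rightarrow> 'v \<Rightarrow> 'v \<Rightarrow> real"
    and D :: "('b, 'v) conn"
  assumes manifold: "smooth_manifold A"
    and vector_bundle_H: "vector_bundle A H"
    and endomorphism: "bundle_morphism A H H J"
    and involution: "\<And>p x. x \<in> fib H p \<Longrightarrow> J p (J p x) = x"
    and equal_rank: "\<And>p. dim {x \<in> fib H p. J p x - x = 0} = dim {x \<in> fib H p. J p x + x = 0}"
    and form: "bilinear_bundle_form A H \<omega>"
    and form_nondegenerate: "nondegenerate H \<omega>"
    and form_skew: "\<And>p x y. x \<in> fib H p \<Longrightarrow> y \<in> fib H p \<Longrightarrow> \<omega> p x y = - \<omega> p y x"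
    and form_J: "\<And>p x y. x \<in> fib H p \<Longrightarrow> y \<in> fib H p \<Longrightarrow> \<omega> p (J p x) (J p y) = - \<omega> p x y"
    and flat: "flat_connection A H D"
    and J_parallel: "\<And>Z s p. Z \<in> vector_fields A \<Longrightarrow> s \<in> sections A H UNIV \<Longrightarrow>
      cov_deriv_end D J Z s p = 0"
    and form_parallel: "\<And>Z s t p. Z \<in> vector_fields A \<Longrightarrow> s \<in> sections A H UNIV \<Longrightarrow>
      t \<in> sections A H UNIV \<Longrightarrow> cov_deriv_form D \<omega> Z s t p = 0"


section \<open>The structure induced by a splitting\<close>

text \<open>The component in \<open>F\<close> of a vector of \<open>F \<oplus> G\<close>.\<close>

definition component :: "('b, 'v::real_vector, 'f) vbundle \<Rightarrow> ('b, 'v, 'g) vbundle \<Rightarrow> 'b \<Rightarrow> 'v \<Rightarrow> 'v" where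
  "component F G p x = (THE y. y \<in> fib F p \<and> x - y \<in> fib G p)"

definition splitting_J :: "('b, 'v::real_vector, 'f) vbundle \<Rightarrow> ('b, 'v, 'g) vbundle \<Rightarrow> 'b \<Rightarrow> 'v \<Rightarrow> 'v" where
  "splitting_J F G p x = component F G p x - component G F p x"

definition splitting_omega :: "('b, 'v::real_vector, 'f) vbundle \<Rightarrow> ('b, 'v, 'g) vbundle \<Rightarrow>
    ('b \<Rightarrow> 'v \<Rightarrow> 'v \<Rightarrow> real) \<Rightarrow> 'b \<Rightarrow> 'v \<Rightarrow> 'v \<Rightarrow> real" where
  "splitting_omega F G g p x y = g p (splitting_J F G p x) y"

definition sum_connection :: "('b, 'v::real_vector, 'f) vbundle \<Rightarrow> ('b, 'v, 'g) vbundle \<Rightarrow>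
    ('b, 'v) conn \<Rightarrow> ('b, 'v) conn \<Rightarrow> ('b, 'v) conn" where
  "sum_connection F G D D' Z s p =
     D Z (\<lambda>q. component F G q (s q)) p + D' Z (\<lambda>q. component G F q (s q)) p"

context legendre_bundle
begin

lemma component_sum:
  assumes "x \<in> fib Hp p" "a \<in> fib Hm p"
  shows "component Hp Hm p (x + a) = x" "component Hm Hp p (x + a) = a"
proof -
  have sub: "subspace (fib Hp p)" "subspace (fib Hm p)"
    using vector_bundle_p vector_bundle_m by (auto simp: vector_bundle_def)
  have zero: "z = 0" if "z \<in> fib Hp p" "z \<in> fib Hm p" for z
    using direct_sum that by (auto simp: direct_sum_bundle_def)
  have "y = x" if y: "y \<in> fib Hp p" "x + a - y \<in> fib Hm p" for y
  proof -
    have "x - y \<in> fib Hp p" using sub(1) assms(1) y(1) by (rule subspace_diff)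
    moreover have "x + a - y - a \<in> fib Hm p" using sub(2) y(2) assms(2) by (rule subspace_diff)
    ultimately show ?thesis using zero[of "x - y"] by (simp add: algebra_simps)
  qed
  with assms show "component Hp Hm p (x + a) = x"
    unfolding component_def by (intro the_equality) auto
  have "y = a" if y: "y \<in> fib Hm p" "x + a - y \<in> fib Hp p" for y
  proof -
    have "a - y \<in> fib Hm p" using sub(2) assms(2) y(1) by (rule subspace_diff)
    moreover have "x + a - y - x \<in> fib Hp p" using sub(1) y(2) assms(1) by (rule subspace_diff)
    ultimately show ?thesis using zero[of "a - y"] by (simp add: algebra_simps)
  qed
  with assms show "component Hm Hp p (x + a) = a"
    unfolding component_def by (intro the_equality) auto
qed

lemma splitting_J_p: "x \<in> fib Hp p \<Longrightarrow> splitting_J Hp Hm p x = x"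
  and splitting_J_m: "a \<in> fib Hm p \<Longrightarrow> splitting_J Hp Hm p a = - a"
proof -
  have z: "0 \<in> fib Hp p" "0 \<in> fib Hm p"
    using vector_bundle_p vector_bundle_m by (auto simp: vector_bundle_def subspace_0)
  show "x \<in> fib Hp p \<Longrightarrow> splitting_J Hp Hm p x = x"
    using component_sum[of x p 0] z by (simp add: splitting_J_def)
  show "a \<in> fib Hm p \<Longrightarrow> splitting_J Hp Hm p a = - a"
    using component_sum[of 0 p a] z by (simp add: splitting_J_def)
qed

end

end

theory Submission
  imports Defs
begin

text \<open>For \<open>s = s\<^sub>+ + s\<^sub>-\<close> one has \<open>J s = s\<^sub>+ - s\<^sub>-\<close>, and since both summands are isotropic,
  \<open>\<omega>(s, t) = g(s\<^sub>+, t\<^sub>-) - g(t\<^sub>+, s\<^sub>-)\<close>; hence \<open>\<nabla>\<omega> = 0\<close> is the difference of two instances of the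
  duality of \<open>\<nabla>\<^sup>+\<close> and \<open>\<nabla>\<^sup>-\<close>. The curvature of \<open>\<nabla>\<^sup>+ \<oplus> \<nabla>\<^sup>-\<close> is the sum of the two curvatures. The
  summands have equal rank because \<open>g\<close> pairs them nondegenerately. That the components of smooth sections are
  smooth comes from the Whitney sum structure; smooth functions being arbitrary outside the relevant
  open set, each such statement also uses that smoothness is local.\<close>

section \<open>Locality and scaling of smooth functions and of smooth sections\<close>

lemma Ck_on_cong:
  assumes "open S" "Ck_on k S f" "\<And>x. x \<in> S \<Longrightarrow> f x = h x"
  shows "Ck_on k S h"
  using assms(2,3)
proof (induction k arbitrary: f h)
  case 0
  then show ?case by (auto intro: continuous_on_eq)
next
  case (Suc k)
  \<comment> \<open>Since \<open>S\<close> is open, \<open>f\<close> and \<open>h\<close> agree on a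
    neighbourhood of \<open>x\<close> and so have the same derivative there; the induction can then
    be applied to the directional derivatives, which again agree only on \<open>S\<close>.\<close>
  have D: "(h has_derivative frechet_derivative f (at x)) (at x)" if "x \<in> S" for x
    using Suc.prems that assms(1)
    by (intro has_derivative_transform_within_open[of f _ x UNIV S h])
      (auto simp: frechet_derivative_works)
  then have eq: "frechet_derivative f (at x) v = frechet_derivative h (at x) v" if "x \<in> S" for x v
    using that frechet_derivative_at by metis
  have "Ck_on k S (\<lambda>x. frechet_derivative h (at x) v)" for v
    by (rule Suc.IH[of "\<lambda>x. frechet_derivative f (at x) v"]) (use Suc.prems(1) eq in simp_all)
  with D show ?case by (auto simp: differentiable_def)
qed

lemma Ck_on_scaleR:
  assumes "open S" "Ck_on k S f"
  shows "Ck_on k S (\<lambda>x. c *\<^sub>R f x)"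
  using assms(2)
proof (induction k arbitrary: f)
  case 0
  then show ?case by (auto intro: continuous_intros)
next
  case (Suc k)
  have D: "((\<lambda>x. c *\<^sub>R f x) has_derivative (\<lambda>v. c *\<^sub>R frechet_derivative f (at x) v)) (at x)"
    if "x \<in> S" for x
    using Suc.prems that by (intro has_derivative_scaleR_right) (auto simp: frechet_derivative_works)
  then have "(\<lambda>v. c *\<^sub>R frechet_derivative f (at x) v) = frechet_derivative (\<lambda>x. c *\<^sub>R f x) (at x)"
    if "x \<in> S" for x
    using that frechet_derivative_at by blast
  then have eq: "c *\<^sub>R frechet_derivative f (at x) v = frechet_derivative (\<lambda>x. c *\<^sub>R f x) (at x) v"
    if "x \<in> S" for x v
    using that by metis
  have "Ck_on k S (\<lambda>x. frechet_derivative (\<lambda>x. c *\<^sub>R f x) (at x) v)" for v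
    using Suc by (intro Ck_on_cong[OF assms(1) Suc.IH eq]) auto
  with D show ?case by (auto simp: differentiable_def)
qed

text \<open>A homeomorphism is open onto its image, and the image of a chart is itself open in the
  model space. This supplies the open set that \<open>Ck_on_cong\<close> and
  \<open>Ck_on_scaleR\<close> ask for when smoothness is tested in charts.\<close>

lemma open_chart_image:
  assumes "chart (W, \<theta>)" "open U"
  shows "open (\<theta> ` (U \<inter> W))"
proof -
  have "homeomorphism W (\<theta> ` W) \<theta> (inv_into W \<theta>)" "open (\<theta> ` W)"
    using assms(1) by (auto simp: chart_def)
  moreover have "openin (top_of_set W) (U \<inter> W)"
    using assms(2) by (auto simp: openin_open)
  ultimately show ?thesis
    using homeomorphism_imp_open_map openin_open_trans by blast
qed

lemma chart_inv_into_mem: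
  assumes "chart (W, \<theta>)" "y \<in> \<theta> ` (U \<inter> W)"
  shows "inv_into W \<theta> y \<in> U"
  using assms by (auto simp: chart_def homeomorphism_def)

text \<open>In a chart, smoothness over \<open>U\<close> is tested on the open image of
  \<open>U\<close>, whose points \<open>inv_into\<close> carries back into \<open>U\<close>; the
  values of \<open>f\<close> and \<open>h\<close> elsewhere never enter.\<close>

lemma smooth_fun_cong:
  assumes "smooth_manifold A" "open U" "smooth_fun A U f" "\<And>p. p \<in> U \<Longrightarrow> f p = h p"
  shows "smooth_fun A U h"
  unfolding smooth_fun_def smooth_on_def
proof (safe)
  fix W \<theta> k assume c: "(W, \<theta>) \<in> A"
  then have ch: "chart (W, \<theta>)" using assms(1) by (auto simp: smooth_manifold_def)
  have "Ck_on k (\<theta> ` (U \<inter> W)) (f \<circ> inv_into W \<theta>)"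
    using assms(3) c by (auto simp: smooth_fun_def smooth_on_def)
  then show "Ck_on k (\<theta> ` (U \<inter> W)) (h \<circ> inv_into W \<theta>)"
    by (rule Ck_on_cong[OF open_chart_image[OF ch assms(2)]])
      (simp add: assms(4) chart_inv_into_mem[OF ch])
qed

lemma smooth_fun_scaleR:
  assumes "smooth_manifold A" "open U" "smooth_fun A U f"
  shows "smooth_fun A U (\<lambda>p. c *\<^sub>R f p)"
  unfolding smooth_fun_def smooth_on_def
proof (safe)
  fix W \<theta> k assume c: "(W, \<theta>) \<in> A"
  then have ch: "chart (W, \<theta>)" using assms(1) by (auto simp: smooth_manifold_def)
  have "Ck_on k (\<theta> ` (U \<inter> W)) (f \<circ> inv_into W \<theta>)"
    using assms(3) c by (auto simp: smooth_fun_def smooth_on_def)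
  then show "Ck_on k (\<theta> ` (U \<inter> W)) ((\<lambda>p. c *\<^sub>R f p) \<circ> inv_into W \<theta>)"
    using Ck_on_scaleR[OF open_chart_image[OF ch assms(2)], of k _ c] by (simp add: o_def)
qed

text \<open>Fibrewise constructions, such as taking components, are controlled only over
  \<open>U\<close>, where the values lie in the fibres. This allows a section to be replaced by
  another expression for it that is equal to it there.\<close>

lemma sections_cong:
  assumes "smooth_manifold A" "vector_bundle A E" "open U"
    and "s \<in> sections A E U" "\<And>p. p \<in> U \<Longrightarrow> s p = t p"
  shows "t \<in> sections A E U"
proof -
  have "smooth_fun A (U \<inter> V) (\<lambda>p. \<Phi> p (t p))" if V: "(V, \<Phi>) \<in> trivs E" for V \<Phi>
  proof (rule smooth_fun_cong[OF assms(1), where f = "\<lambda>p. \<Phi> p (s p)"])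
    show "open (U \<inter> V)" using assms(2,3) V by (auto simp: vector_bundle_def)
    show "smooth_fun A (U \<inter> V) (\<lambda>p. \<Phi> p (s p))" using assms(4) V by (auto simp: sections_def)
  qed (use assms(5) in auto)
  with assms(4,5) show ?thesis by (auto simp: sections_def)
qed

text \<open>A trivialisation is linear only on the fibre, so it commutes with the scalar only over
  \<open>U\<close>, and the conclusion goes through \<open>smooth_fun_cong\<close>. The values -1
  and 0 of \<open>c\<close> later give negatives of sections and the zero section.\<close>

lemma sections_scaleR:
  assumes "smooth_manifold A" "vector_bundle A E" "open U" "s \<in> sections A E U"
  shows "(\<lambda>p. c *\<^sub>R s p) \<in> sections A E U"
proof -
  have "smooth_fun A (U \<inter> V) (\<lambda>p. \<Phi> p (c *\<^sub>R s p))" if V: "(V, \<Phi>) \<in> trivs E" for V \<Phi>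
  proof (rule smooth_fun_cong[OF assms(1), where f = "\<lambda>p. c *\<^sub>R \<Phi> p (s p)"])
    show o: "open (U \<inter> V)" using assms(2,3) V by (auto simp: vector_bundle_def)
    show "smooth_fun A (U \<inter> V) (\<lambda>p. c *\<^sub>R \<Phi> p (s p))"
      using assms(4) V by (intro smooth_fun_scaleR[OF assms(1) o]) (auto simp: sections_def)
    fix p assume "p \<in> U \<inter> V"
    moreover from this have "linear_from (fib E p) (\<Phi> p)" "s p \<in> fib E p"
      using assms(2,4) V by (auto simp: vector_bundle_def sections_def)
    ultimately show "c *\<^sub>R \<Phi> p (s p) = \<Phi> p (c *\<^sub>R s p)" by (simp add: linear_from_def)
  qed
  moreover have "c *\<^sub>R s p \<in> fib E p" if "p \<in> U" for p
    using assms(2,4) that by (auto simp: vector_bundle_def sections_def intro: subspace_scale)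
  ultimately show ?thesis by (auto simp: sections_def)
qed

section \<open>Rules for connections\<close>

lemma connectionD:
  assumes "connection A E D" "Z \<in> vector_fields A" "s \<in> sections A E UNIV"
  shows connection_section: "D Z s \<in> sections A E UNIV"
    and connection_add_field: "Y \<in> vector_fields A \<Longrightarrow>
      D (\<lambda>p. Y p + Z p) s = (\<lambda>p. D Y s p + D Z s p)"
    and connection_add_section: "t \<in> sections A E UNIV \<Longrightarrow>
      D Z (\<lambda>p. s p + t p) = (\<lambda>p. D Z s p + D Z t p)"
    and connection_scale_field: "smooth_fun A UNIV f \<Longrightarrow>
      D (\<lambda>p. f p *\<^sub>R Z p) s = (\<lambda>p. f p *\<^sub>R D Z s p)"
    and connection_scale_section: "smooth_fun A UNIV f \<Longrightarrow>
      D Z (\<lambda>p. f p *\<^sub>R s p) = (\<lambda>p. Z p f *\<^sub>R s p + f p *\<^sub>R D Z s p)"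
proof -
  show "D Z s \<in> sections A E UNIV"
    using assms unfolding connection_def by blast
  show "D (\<lambda>p. Y p + Z p) s = (\<lambda>p. D Y s p + D Z s p)" if "Y \<in> vector_fields A"
    using assms that unfolding connection_def by blast
  show "D Z (\<lambda>p. s p + t p) = (\<lambda>p. D Z s p + D Z t p)" if "t \<in> sections A E UNIV"
    using assms that unfolding connection_def by blast
  show "D (\<lambda>p. f p *\<^sub>R Z p) s = (\<lambda>p. f p *\<^sub>R D Z s p)" if "smooth_fun A UNIV f"
    using assms that unfolding connection_def by blast
  show "D Z (\<lambda>p. f p *\<^sub>R s p) = (\<lambda>p. Z p f *\<^sub>R s p + f p *\<^sub>R D Z s p)" if "smooth_fun A UNIV f"
    using assms that unfolding connection_def by blast
qed

lemma connection_minus: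
  assumes "smooth_manifold A" "vector_bundle A E" "connection A E D"
    and "Z \<in> vector_fields A" "s \<in> sections A E UNIV"
  shows "D Z (\<lambda>p. - s p) p = - D Z s p"
proof -
  have sc: "(\<lambda>p. c *\<^sub>R s p) \<in> sections A E UNIV" for c
    using sections_scaleR[OF assms(1,2) _ assms(5)] by simp
  have neg: "(\<lambda>p. - s p) \<in> sections A E UNIV" using sc[of "-1"] by simp
  have zero: "(\<lambda>p. 0) \<in> sections A E UNIV" using sc[of 0] by simp
  note add = connection_add_section[OF assms(3,4)]
  \<comment> \<open>Additivity alone suffices: 0 + 0 = 0 makes the derivative of the zero section
    vanish, and then \<open>s + (- s) = 0\<close> gives the sign rule.\<close>
  have "D Z (\<lambda>p. 0) p = 0" using fun_cong[OF add[OF zero zero], of p] by simp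
  then show ?thesis
    using fun_cong[OF add[OF assms(5) neg], of p] by (simp add: eq_neg_iff_add_eq_0 add.commute)
qed

section \<open>Linear algebra of fibres and of nondegenerate pairings\<close>

lemma linear_inv_into_UNIV:
  assumes "subspace V" "linear_from V \<Phi>" "bij_betw \<Phi> V UNIV"
  shows "linear (inv_into V \<Phi>)"
proof -
  have inv: "inv_into V \<Phi> w \<in> V" "\<Phi> (inv_into V \<Phi> w) = w" for w
    using assms(3) by (auto simp: bij_betw_def inv_into_into f_inv_into_f)
  \<comment> \<open>A preimage in \<open>V\<close> is unique, so linearity of the inverse reduces to
    linearity of \<open>\<Phi>\<close> on \<open>V\<close>.\<close>
  have eq: "inv_into V \<Phi> w = x" if "x \<in> V" "\<Phi> x = w" for x w
    using that assms(3) by (auto simp: bij_betw_def)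
  show ?thesis
  proof (rule linearI)
    show "inv_into V \<Phi> (a + b) = inv_into V \<Phi> a + inv_into V \<Phi> b" for a b
      by (rule eq) (use assms(1,2) inv in \<open>auto simp: linear_from_def subspace_add\<close>)
    show "inv_into V \<Phi> (c *\<^sub>R a) = c *\<^sub>R inv_into V \<Phi> a" for c a
      by (rule eq) (use assms(1,2) inv in \<open>auto simp: linear_from_def subspace_scale\<close>)
  qed
qed

text \<open>The parametrisation is the inverse of a trivialisation at \<open>p\<close>. It carries
  the standard basis of the model fibre to a basis of the fibre, which determines the dimension even
  though the ambient space \<open>'v\<close> may be infinite-dimensional.\<close>

lemma fib_linear_parametrization:
  fixes E :: "('b::topological_space, 'v::real_vector, 'f::euclidean_space) vbundle"
  assumes "vector_bundle A E"
  obtains \<phi> :: "'f \<Rightarrow> 'v" where "linear \<phi>" "inj \<phi>" "range \<phi> = fib E p" "dim (fib E p) = DIM('f)"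
proof -
  have "p \<in> (\<Union>(U, \<Phi>)\<in>trivs E. U)" using assms by (simp add: vector_bundle_def)
  then obtain U \<Phi> where "(U, \<Phi>) \<in> trivs E" "p \<in> U" by blast
  then have \<Phi>: "subspace (fib E p)" "linear_from (fib E p) (\<Phi> p)" "bij_betw (\<Phi> p) (fib E p) UNIV"
    using assms by (auto simp: vector_bundle_def)
  let ?\<phi> = "inv_into (fib E p) (\<Phi> p)"
  have "bij_betw ?\<phi> UNIV (fib E p)" using \<Phi>(3) by (rule bij_betw_inv_into)
  then have b: "inj ?\<phi>" "range ?\<phi> = fib E p" by (auto simp: bij_betw_def)
  have l: "linear ?\<phi>" using linear_inv_into_UNIV[OF \<Phi>] .
  have "independent (?\<phi> ` Basis)"
    using linear_independent_injective_image[OF l independent_Basis] b(1) by (simp add: inj_on_subset)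
  moreover have "span (?\<phi> ` Basis) = fib E p"
    using linear_span_image[OF l, of Basis] b(2) by simp
  ultimately have "dim (fib E p) = card (?\<phi> ` Basis)"
    by (metis dim_eq_card_independent dim_span)
  also have "\<dots> = DIM('f)" using b(1) by (simp add: card_image inj_on_subset)
  finally show ?thesis using that[OF l b] by blast
qed

text \<open>The map \<open>?L\<close> sends \<open>x\<close> to the vector that represents the
  functional \<open>\<beta> x\<close> through the inner product; its coordinates are the values of
  \<open>\<beta> x\<close> on the basis. Nondegeneracy in the first argument makes it
  injective.\<close>

lemma DIM_le_of_nondegenerate_pairing:
  fixes \<beta> :: "'a::euclidean_space \<Rightarrow> 'c::euclidean_space \<Rightarrow> real"
  assumes "\<And>y. linear (\<lambda>x. \<beta> x y)" "\<And>x. linear (\<beta> x)" "\<And>x. (\<And>y. \<beta> x y = 0) \<Longrightarrow> x = 0"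
  shows "DIM('a) \<le> DIM('c)"
proof -
  let ?L = "\<lambda>x. \<Sum>b\<in>Basis. \<beta> x b *\<^sub>R b"
  have l: "linear ?L"
    by (rule linearI)
      (simp_all add: linear_add[OF assms(1)] linear_scale[OF assms(1)]
        scaleR_add_left sum.distrib scaleR_sum_right)
  have "x = 0" if "?L x = 0" for x
  proof (rule assms(3))
    have b: "\<beta> x b = 0" if "b \<in> Basis" for b
      using that arg_cong[OF \<open>?L x = 0\<close>, of "\<lambda>z. z \<bullet> b"] by simp
    show "\<beta> x y = 0" for y
      using linear_eq_on_span[OF assms(2) linear_zero, of Basis x y] b by simp
  qed
  then have "inj ?L" using l by (simp add: linear_injective_0)
  then show ?thesis
    using dim_image_eq[OF l, of UNIV] dim_subset_UNIV[of "range ?L"] by simp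
qed

section \<open>Components with respect to the splitting, and the endomorphism J\<close>

context legendre_bundle
begin

abbreviation "Jsplit \<equiv> splitting_J Hp Hm"
abbreviation "cp \<equiv> component Hp Hm"
abbreviation "cm \<equiv> component Hm Hp"

lemma subspace_fib: "subspace (fib H p)" "subspace (fib Hp p)" "subspace (fib Hm p)"
  using vector_bundle_H vector_bundle_p vector_bundle_m by (simp_all add: vector_bundle_def)

lemma fib_H: "fib H p = {y + a | y a. y \<in> fib Hp p \<and> a \<in> fib Hm p}"
  using direct_sum[unfolded direct_sum_bundle_def, THEN conjunct1] by simp

lemma fib_decompose:
  assumes "x \<in> fib H p"
  obtains y a where "y \<in> fib Hp p" "a \<in> fib Hm p" "x = y + a"
  using assms unfolding fib_H by blast

lemma fib_sumI: "y \<in> fib Hp p \<Longrightarrow> a \<in> fib Hm p \<Longrightarrow> y + a \<in> fib H p"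
  unfolding fib_H by blast

lemma fib_sub: "y \<in> fib Hp p \<Longrightarrow> y \<in> fib H p" "a \<in> fib Hm p \<Longrightarrow> a \<in> fib H p"
  using fib_sumI[of y p 0] fib_sumI[of 0 p a] subspace_0[OF subspace_fib(2)]
    subspace_0[OF subspace_fib(3)] by simp_all

lemma component_mem: "x \<in> fib H p \<Longrightarrow> cp p x \<in> fib Hp p" "x \<in> fib H p \<Longrightarrow> cm p x \<in> fib Hm p"
  and component_add_eq: "x \<in> fib H p \<Longrightarrow> cp p x + cm p x = x"
  by (erule fib_decompose, simp add: component_sum)+

text \<open>The sums of the components are again a decomposition along the splitting, and
  decompositions are unique by \<open>component_sum\<close>.\<close>

lemma component_add:
  assumes "x \<in> fib H p" "y \<in> fib H p"
  shows "cp p (x + y) = cp p x + cp p y" "cm p (x + y) = cm p x + cm p y"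
proof -
  have eq: "x + y = (cp p x + cp p y) + (cm p x + cm p y)"
    using component_add_eq[OF assms(1)] component_add_eq[OF assms(2)] by (simp add: algebra_simps)
  have m: "cp p x + cp p y \<in> fib Hp p" "cm p x + cm p y \<in> fib Hm p"
    using assms subspace_fib by (auto intro!: subspace_add component_mem)
  show "cp p (x + y) = cp p x + cp p y" "cm p (x + y) = cm p x + cm p y"
    unfolding eq using component_sum[OF m] by auto
qed

lemma component_scaleR:
  assumes "x \<in> fib H p"
  shows "cp p (c *\<^sub>R x) = c *\<^sub>R cp p x" "cm p (c *\<^sub>R x) = c *\<^sub>R cm p x"
proof -
  have eq: "c *\<^sub>R x = c *\<^sub>R cp p x + c *\<^sub>R cm p x"
    using component_add_eq[OF assms] by (metis scaleR_add_right)
  have m: "c *\<^sub>R cp p x \<in> fib Hp p" "c *\<^sub>R cm p x \<in> fib Hm p"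
    using assms subspace_fib by (auto intro!: subspace_scale component_mem)
  show "cp p (c *\<^sub>R x) = c *\<^sub>R cp p x" "cm p (c *\<^sub>R x) = c *\<^sub>R cm p x"
    unfolding eq using component_sum[OF m] by auto
qed

lemma J_sum: "y \<in> fib Hp p \<Longrightarrow> a \<in> fib Hm p \<Longrightarrow> Jsplit p (y + a) = y - a"
  by (simp add: splitting_J_def component_sum)

lemma J_mem: "x \<in> fib H p \<Longrightarrow> Jsplit p x \<in> fib H p"
  by (erule fib_decompose) (simp add: J_sum subspace_diff[OF subspace_fib(1)] fib_sub)

lemma linear_J: "linear_from (fib H p) (Jsplit p)"
  by (auto simp: linear_from_def splitting_J_def component_add component_scaleR algebra_simps)

lemma sections_fib: "s \<in> sections A E U \<Longrightarrow> p \<in> U \<Longrightarrow> s p \<in> fib E p"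
  by (simp add: sections_def)

lemma sections_sum:
  assumes "open U" "\<And>p. p \<in> U \<Longrightarrow> y p \<in> fib Hp p" "\<And>p. p \<in> U \<Longrightarrow> a p \<in> fib Hm p"
  shows "(\<lambda>p. y p + a p) \<in> sections A H U \<longleftrightarrow> y \<in> sections A Hp U \<and> a \<in> sections A Hm U"
  using direct_sum[unfolded direct_sum_bundle_def, THEN conjunct2, rule_format, of U y a] assms by simp

text \<open>The Whitney sum clause speaks of sections written as a sum of a part in
  \<open>Hp\<close> and a part in \<open>Hm\<close>. The sum of the components of \<open>s\<close>
  is known to equal \<open>s\<close> only over \<open>U\<close>, whence the passage through
  \<open>sections_cong\<close>.\<close>

lemma sections_component:
  assumes "open U" "s \<in> sections A H U"
  shows "(\<lambda>p. cp p (s p)) \<in> sections A Hp U" "(\<lambda>p. cm p (s p)) \<in> sections A Hm U"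
proof -
  have "(\<lambda>p. cp p (s p) + cm p (s p)) \<in> sections A H U"
    by (rule sections_cong[OF manifold vector_bundle_H assms])
      (simp add: component_add_eq sections_fib[OF assms(2)])
  then show "(\<lambda>p. cp p (s p)) \<in> sections A Hp U" "(\<lambda>p. cm p (s p)) \<in> sections A Hm U"
    using sections_sum[OF assms(1), of "\<lambda>p. cp p (s p)" "\<lambda>p. cm p (s p)"]
      component_mem sections_fib[OF assms(2)] by auto
qed

lemma sections_minus_m:
  assumes "open U" "a \<in> sections A Hm U"
  shows "(\<lambda>p. - a p) \<in> sections A Hm U"
  using sections_scaleR[OF manifold vector_bundle_m assms, of "-1"] by simp

lemma sections_J:
  assumes "open U" "s \<in> sections A H U"
  shows "(\<lambda>p. Jsplit p (s p)) \<in> sections A H U"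
proof -
  note c = sections_component[OF assms]
  note m = sections_minus_m[OF assms(1) c(2)]
  have "(\<lambda>p. cp p (s p) + - cm p (s p)) \<in> sections A H U"
    using sections_sum[OF assms(1) sections_fib[OF c(1)] sections_fib[OF m]] c(1) m by blast
  then show ?thesis by (simp add: splitting_J_def)
qed

text \<open>Smoothness of \<open>g\<close> is available only on sections of \<open>H\<close>, so
  each component is regarded as one by adding the zero section of the other summand.\<close>

lemma sections_component_H:
  assumes "open U" "s \<in> sections A H U"
  shows "(\<lambda>p. cp p (s p)) \<in> sections A H U" "(\<lambda>p. cm p (s p)) \<in> sections A H U"
proof -
  note c = sections_component[OF assms]
  have zp: "(\<lambda>p. 0) \<in> sections A Hp U"
    using sections_scaleR[OF manifold vector_bundle_p assms(1) c(1), of 0] by simp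
  have zm: "(\<lambda>p. 0) \<in> sections A Hm U"
    using sections_scaleR[OF manifold vector_bundle_m assms(1) c(2), of 0] by simp
  show "(\<lambda>p. cp p (s p)) \<in> sections A H U"
    using sections_sum[OF assms(1) sections_fib[OF c(1)] sections_fib[OF zm]] c zm by simp
  show "(\<lambda>p. cm p (s p)) \<in> sections A H U"
    using sections_sum[OF assms(1) sections_fib[OF zp] sections_fib[OF c(2)]] c zp by simp
qed

section \<open>The forms in components, and the ranks of the two summands\<close>

lemma g_add:
  assumes "x \<in> fib H p" "y \<in> fib H p" "z \<in> fib H p"
  shows "g p x (y + z) = g p x y + g p x z" "g p (y + z) x = g p y x + g p z x"
  using assms form by (auto simp: bilinear_bundle_form_def linear_from_def)

lemma g_scaleR:
  assumes "x \<in> fib H p" "y \<in> fib H p"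
  shows "g p x (c *\<^sub>R y) = c * g p x y" "g p (c *\<^sub>R y) x = c * g p y x"
  using assms form by (auto simp: bilinear_bundle_form_def linear_from_def)

text \<open>Isotropy removes two of the four terms, and symmetry puts the \<open>Hp\<close> entry
  first in both remaining ones, the order in which the duality of the connections is stated.\<close>

lemma g_sum:
  assumes "y \<in> fib Hp p" "a \<in> fib Hm p" "z \<in> fib Hp p" "b \<in> fib Hm p"
  shows "g p (y + a) (z + b) = g p y b + g p z a"
  using assms g_add fib_sub fib_sumI
  by (simp add: form_p form_m form_sym[OF fib_sub(2)[OF assms(2)] fib_sub(1)[OF assms(3)]])

text \<open>Applying J replaces \<open>a\<close> by \<open>- a\<close> in \<open>g_sum\<close>.
  Under the identifications with tangent and cotangent vectors this is the canonical symplectic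
  form, \<open>b\<close> evaluated at \<open>y\<close> minus \<open>a\<close> evaluated at
  \<open>z\<close>.\<close>

lemma omega_sum:
  assumes "y \<in> fib Hp p" "a \<in> fib Hm p" "z \<in> fib Hp p" "b \<in> fib Hm p"
  shows "splitting_omega Hp Hm g p (y + a) (z + b) = g p y b - g p z a"
proof -
  have "- a \<in> fib Hm p" using assms(2) subspace_fib(3) by (rule subspace_neg[rotated])
  moreover have "g p z (- a) = - g p z a"
    using g_scaleR(1)[of z p a "-1"] assms fib_sub by simp
  ultimately show ?thesis
    using g_sum[of y p "- a" z b] assms by (simp add: splitting_omega_def J_sum)
qed

text \<open>Pulled back to the model fibres, \<open>g\<close> becomes a pairing of \<open>'g\<close>
  with \<open>'h\<close> that is nondegenerate on both sides, so each dimension bounds the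
  other.\<close>

lemma dim_fib_eq: "dim (fib Hp p) = dim (fib Hm p)"
proof -
  obtain \<phi> :: "'g \<Rightarrow> 'v" where \<phi>: "linear \<phi>" "inj \<phi>" "range \<phi> = fib Hp p" "dim (fib Hp p) = DIM('g)"
    using fib_linear_parametrization[OF vector_bundle_p] by blast
  obtain \<psi> :: "'h \<Rightarrow> 'v" where \<psi>: "linear \<psi>" "inj \<psi>" "range \<psi> = fib Hm p" "dim (fib Hm p) = DIM('h)"
    using fib_linear_parametrization[OF vector_bundle_m] by blast
  have mem: "\<phi> u \<in> fib Hp p" "\<psi> w \<in> fib Hm p" for u w using \<phi>(3) \<psi>(3) by auto
  note memH = fib_sub(1)[OF mem(1)] fib_sub(2)[OF mem(2)]
  have l: "linear (\<lambda>u. g p (\<phi> u) (\<psi> w))" "linear (\<lambda>w. g p (\<phi> u) (\<psi> w))" for u w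
    by (rule linearI; simp add: linear_add[OF \<phi>(1)] linear_add[OF \<psi>(1)] linear_scale[OF \<phi>(1)]
        linear_scale[OF \<psi>(1)] g_add g_scaleR memH)+
  have nd: "x = 0" if "x \<in> fib H p" "\<And>y. y \<in> fib H p \<Longrightarrow> g p x y = 0" for x
    using form_nondegenerate that by (auto simp: nondegenerate_def)
  have "DIM('g) \<le> DIM('h)"
  proof (rule DIM_le_of_nondegenerate_pairing[of "\<lambda>u w. g p (\<phi> u) (\<psi> w)", OF l])
    fix u assume u: "g p (\<phi> u) (\<psi> w) = 0" for w
    \<comment> \<open>The vector \<open>\<phi> u\<close> is orthogonal to \<open>Hm\<close> by
      assumption and to \<open>Hp\<close> by isotropy, hence to all of \<open>H\<close>.\<close>
    have "\<phi> u = 0"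
    proof (rule nd[OF memH(1)])
      fix y assume "y \<in> fib H p"
      then obtain z b where y: "z \<in> fib Hp p" "b \<in> fib Hm p" "y = z + b" by (rule fib_decompose)
      moreover obtain w where "b = \<psi> w" using y(2) \<psi>(3) by blast
      ultimately show "g p (\<phi> u) y = 0"
        using u g_add(1) memH fib_sub form_p[OF mem(1)] by simp
    qed
    then show "u = 0" using \<phi>(1,2) by (simp add: linear_injective_0)
  qed
  moreover have "DIM('h) \<le> DIM('g)"
  proof (rule DIM_le_of_nondegenerate_pairing[of "\<lambda>w u. g p (\<phi> u) (\<psi> w)", OF l(2,1)])
    fix w assume w: "g p (\<phi> u) (\<psi> w) = 0" for u
    have "\<psi> w = 0"
    proof (rule nd[OF memH(2)])
      fix y assume "y \<in> fib H p"
      then obtain z b where y: "z \<in> fib Hp p" "b \<in> fib Hm p" "y = z + b" by (rule fib_decompose)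
      moreover obtain u where "z = \<phi> u" using y(1) \<phi>(3) by blast
      ultimately show "g p (\<psi> w) y = 0"
        using w g_add(1) memH fib_sub form_m[OF mem(2)] form_sym[OF memH(2) memH(1)] by simp
    qed
    then show "w = 0" using \<psi>(1,2) by (simp add: linear_injective_0)
  qed
  ultimately show ?thesis using \<phi>(4) \<psi>(4) by simp
qed

text \<open>For \<open>x = y + a\<close>, the equation J x = x amounts to 2 a = 0 and J x = - x to 2
  y = 0.\<close>

lemma J_eigenspaces:
  "{x \<in> fib H p. Jsplit p x - x = 0} = fib Hp p" "{x \<in> fib H p. Jsplit p x + x = 0} = fib Hm p"
proof -
  have double: "z = 0" if "z + z = 0" for z :: 'v
  proof -
    have "2 *\<^sub>R z = 0" unfolding scaleR_2 by (rule that)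
    then show ?thesis by simp
  qed
  have "x \<in> fib Hp p" if x: "x \<in> fib H p" "Jsplit p x = x" for x
  proof -
    obtain y a where d: "y \<in> fib Hp p" "a \<in> fib Hm p" "x = y + a" using x(1) by (rule fib_decompose)
    have "a + a = (y + a) - (y - a)" by simp
    also have "\<dots> = 0" using x(2)[unfolded d(3) J_sum[OF d(1,2)]] by simp
    finally show ?thesis using d double[of a] by simp
  qed
  then show "{x \<in> fib H p. Jsplit p x - x = 0} = fib Hp p"
    by (auto simp: splitting_J_p fib_sub)
  have "x \<in> fib Hm p" if x: "x \<in> fib H p" "Jsplit p x + x = 0" for x
  proof -
    obtain y a where d: "y \<in> fib Hp p" "a \<in> fib Hm p" "x = y + a" using x(1) by (rule fib_decompose)
    have "y + y = (y - a) + (y + a)" by simp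
    also have "\<dots> = 0" using x(2)[unfolded d(3) J_sum[OF d(1,2)]] .
    finally show ?thesis using d double[of y] by simp
  qed
  then show "{x \<in> fib H p. Jsplit p x + x = 0} = fib Hm p"
    by (auto simp: splitting_J_m fib_sub)
qed

section \<open>The sum connection and its flatness\<close>

abbreviation "Dsum \<equiv> sum_connection Hp Hm Dp Dm"

text \<open>A connection takes a whole section as its argument, so the component rules are needed as
  equalities of functions; they hold at every point because \<open>s\<close> and \<open>t\<close>
  are global sections.\<close>

lemma component_section_eq:
  assumes "s \<in> sections A H UNIV" "t \<in> sections A H UNIV"
  shows "(\<lambda>p. cp p (s p + t p)) = (\<lambda>p. cp p (s p) + cp p (t p))"
    and "(\<lambda>p. cm p (s p + t p)) = (\<lambda>p. cm p (s p) + cm p (t p))"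
    and "(\<lambda>p. cp p (f p *\<^sub>R s p)) = (\<lambda>p. f p *\<^sub>R cp p (s p))"
    and "(\<lambda>p. cm p (f p *\<^sub>R s p)) = (\<lambda>p. f p *\<^sub>R cm p (s p))"
  by (simp_all add: component_add component_scaleR sections_fib[OF assms(1)] sections_fib[OF assms(2)])

lemma connection_p: "connection A Hp Dp" and connection_m: "connection A Hm Dm"
  using flat_p flat_m by (auto simp: flat_connection_def)

lemma sections_D:
  assumes "Z \<in> vector_fields A" "s \<in> sections A H UNIV"
  shows "Dp Z (\<lambda>q. cp q (s q)) \<in> sections A Hp UNIV" "Dm Z (\<lambda>q. cm q (s q)) \<in> sections A Hm UNIV"
  using connection_section[OF connection_p assms(1)] connection_section[OF connection_m assms(1)]
    sections_component[OF open_UNIV assms(2)] by blast+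

text \<open>The two summands that define \<open>Dsum Z s\<close> lie in \<open>Hp\<close> and
  \<open>Hm\<close>, so they are its components. This is what allows \<open>Dsum\<close> to be
  iterated and to be inserted into J and \<omega>.\<close>

lemma component_Dsum:
  assumes "Z \<in> vector_fields A" "s \<in> sections A H UNIV"
  shows "(\<lambda>p. cp p (Dsum Z s p)) = Dp Z (\<lambda>q. cp q (s q))"
    and "(\<lambda>p. cm p (Dsum Z s p)) = Dm Z (\<lambda>q. cm q (s q))"
  using sections_fib[OF sections_D(1)[OF assms]] sections_fib[OF sections_D(2)[OF assms]]
  by (auto simp: fun_eq_iff sum_connection_def component_sum)

lemma Dsum_connection: "connection A H Dsum"
  unfolding connection_def
proof (intro conjI ballI allI impI)
  fix Z s assume h: "Z \<in> vector_fields A" "s \<in> sections A H UNIV"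
  note c = sections_component[OF open_UNIV h(2)]
  show "Dsum Z s \<in> sections A H UNIV"
    using sections_sum[OF open_UNIV, of "Dp Z (\<lambda>q. cp q (s q))" "Dm Z (\<lambda>q. cm q (s q))"]
      sections_D[OF h] sections_fib[OF sections_D(1)[OF h]] sections_fib[OF sections_D(2)[OF h]]
    by (simp add: sum_connection_def[abs_def])
  {
    fix Y assume Y: "Y \<in> vector_fields A"
    have "Dp (\<lambda>p. Y p + Z p) (\<lambda>q. cp q (s q)) = (\<lambda>p. Dp Y (\<lambda>q. cp q (s q)) p + Dp Z (\<lambda>q. cp q (s q)) p)"
      "Dm (\<lambda>p. Y p + Z p) (\<lambda>q. cm q (s q)) = (\<lambda>p. Dm Y (\<lambda>q. cm q (s q)) p + Dm Z (\<lambda>q. cm q (s q)) p)"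
      using connection_add_field[OF connection_p h(1) c(1) Y]
        connection_add_field[OF connection_m h(1) c(2) Y] .
    then show "Dsum (\<lambda>p. Y p + Z p) s = (\<lambda>p. Dsum Y s p + Dsum Z s p)"
      by (auto simp: sum_connection_def fun_eq_iff algebra_simps)
  }
  {
    fix t assume t: "t \<in> sections A H UNIV"
    note d = sections_component[OF open_UNIV t]
    have "Dp Z (\<lambda>q. cp q (s q) + cp q (t q)) = (\<lambda>p. Dp Z (\<lambda>q. cp q (s q)) p + Dp Z (\<lambda>q. cp q (t q)) p)"
      "Dm Z (\<lambda>q. cm q (s q) + cm q (t q)) = (\<lambda>p. Dm Z (\<lambda>q. cm q (s q)) p + Dm Z (\<lambda>q. cm q (t q)) p)"
      using connection_add_section[OF connection_p h(1) c(1) d(1)]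
        connection_add_section[OF connection_m h(1) c(2) d(2)] .
    then show "Dsum Z (\<lambda>p. s p + t p) = (\<lambda>p. Dsum Z s p + Dsum Z t p)"
      by (auto simp: sum_connection_def fun_eq_iff algebra_simps component_section_eq[OF h(2) t])
  }
next
  fix f Z s assume f: "smooth_fun A UNIV (f :: 'b \<Rightarrow> real)"
    and h: "Z \<in> vector_fields A" "s \<in> sections A H UNIV"
  note c = sections_component[OF open_UNIV h(2)]
  have "Dp (\<lambda>p. f p *\<^sub>R Z p) (\<lambda>q. cp q (s q)) = (\<lambda>p. f p *\<^sub>R Dp Z (\<lambda>q. cp q (s q)) p)"
    "Dm (\<lambda>p. f p *\<^sub>R Z p) (\<lambda>q. cm q (s q)) = (\<lambda>p. f p *\<^sub>R Dm Z (\<lambda>q. cm q (s q)) p)"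
    using connection_scale_field[OF connection_p h(1) c(1) f]
      connection_scale_field[OF connection_m h(1) c(2) f] .
  then show "Dsum (\<lambda>p. f p *\<^sub>R Z p) s = (\<lambda>p. f p *\<^sub>R Dsum Z s p)"
    by (auto simp: sum_connection_def fun_eq_iff scaleR_add_right)
  have "Dp Z (\<lambda>q. f q *\<^sub>R cp q (s q)) = (\<lambda>p. Z p f *\<^sub>R cp p (s p) + f p *\<^sub>R Dp Z (\<lambda>q. cp q (s q)) p)"
    "Dm Z (\<lambda>q. f q *\<^sub>R cm q (s q)) = (\<lambda>p. Z p f *\<^sub>R cm p (s p) + f p *\<^sub>R Dm Z (\<lambda>q. cm q (s q)) p)"
    using connection_scale_section[OF connection_p h(1) c(1) f]
      connection_scale_section[OF connection_m h(1) c(2) f] .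
  \<comment> \<open>The derivative of \<open>f\<close> appears once for each component; the two
    terms recombine to the single one in the Leibniz rule for \<open>s\<close>.\<close>
  moreover have "Z p f *\<^sub>R s p = Z p f *\<^sub>R cp p (s p) + Z p f *\<^sub>R cm p (s p)" for p
    using component_add_eq[OF sections_fib[OF h(2) UNIV_I]] by (metis scaleR_add_right)
  ultimately show "Dsum Z (\<lambda>p. f p *\<^sub>R s p) = (\<lambda>p. Z p f *\<^sub>R s p + f p *\<^sub>R Dsum Z s p)"
    by (simp add: sum_connection_def fun_eq_iff scaleR_add_right component_section_eq[OF h(2) h(2)])
qed

lemma Dsum_flat: "flat_connection A H Dsum"
  unfolding flat_connection_def
proof (intro conjI ballI allI Dsum_connection)
  fix X Y s p assume h: "X \<in> vector_fields A" "Y \<in> vector_fields A" "s \<in> sections A H UNIV"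
  note c = sections_component[OF open_UNIV h(3)]
  have "curvature A Dp X Y (\<lambda>q. cp q (s q)) p = 0" "curvature A Dm X Y (\<lambda>q. cm q (s q)) p = 0"
    using flat_p flat_m c h(1,2) by (auto simp: flat_connection_def)
  \<comment> \<open>No mixed terms arise, since \<open>Dsum Y s\<close> has the components given by
    \<open>component_Dsum\<close>. The definition is instantiated so that only the outer derivative
    unfolds and the inner one still matches that lemma.\<close>
  moreover have "Dsum X (Dsum Y s) p =
      Dp X (Dp Y (\<lambda>q. cp q (s q))) p + Dm X (Dm Y (\<lambda>q. cm q (s q))) p"
    "Dsum Y (Dsum X s) p = Dp Y (Dp X (\<lambda>q. cp q (s q))) p + Dm Y (Dm X (\<lambda>q. cm q (s q))) p"
    by (simp_all add: sum_connection_def[of Hp Hm Dp Dm X "Dsum Y s"]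
        sum_connection_def[of Hp Hm Dp Dm Y "Dsum X s"] component_Dsum h)
  ultimately show "curvature A Dsum X Y s p = 0"
    by (simp add: curvature_def sum_connection_def[of Hp Hm Dp Dm _ s] algebra_simps)
qed

section \<open>Parallelism of J and \<omega>\<close>

lemma J_parallel:
  assumes "Z \<in> vector_fields A" "s \<in> sections A H UNIV"
  shows "cov_deriv_end Dsum Jsplit Z s p = 0"
proof -
  note c = sections_component[OF open_UNIV assms(2)]
  have fib: "cp q (s q) \<in> fib Hp q" "- cm q (s q) \<in> fib Hm q" for q
    using sections_fib[OF c(1)] sections_fib[OF sections_minus_m[OF open_UNIV c(2)]] by auto
  have "cp q (Jsplit q (s q)) = cp q (s q)" "cm q (Jsplit q (s q)) = - cm q (s q)" for q
    using component_sum[OF fib] by (simp_all add: splitting_J_def)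
  \<comment> \<open>J changes only the sign of the \<open>Hm\<close> component, and that sign passes
    through \<open>Dm\<close>; since \<open>Dsum\<close> differentiates the components separately,
    it commutes with J.\<close>
  then have "Dsum Z (\<lambda>q. Jsplit q (s q)) p
      = Dp Z (\<lambda>q. cp q (s q)) p - Dm Z (\<lambda>q. cm q (s q)) p"
    using connection_minus[OF manifold vector_bundle_m connection_m assms(1) c(2)]
    by (simp add: sum_connection_def)
  also have "\<dots> = Jsplit p (Dsum Z s p)"
    using fun_cong[OF component_Dsum(1)[OF assms]] fun_cong[OF component_Dsum(2)[OF assms]]
    by (simp add: splitting_J_def)
  finally show ?thesis by (simp add: cov_deriv_end_def)
qed

text \<open>A tangent vector is linear only on functions smooth near \<open>p\<close>, and its
  definition provides sums and scalar multiples; the difference is therefore written as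
  \<open>f\<close> plus -1 times \<open>h\<close>.\<close>

lemma tangent_diff:
  assumes "v \<in> tangent_space A p" "smooth_fun A UNIV f" "smooth_fun A UNIV h"
  shows "v (\<lambda>q. f q - h q) = v f - v h"
proof -
  have near: "smooth_near A p f" "smooth_near A p h" "smooth_near A p (\<lambda>q. - 1 * h q)"
    using assms(2,3) smooth_fun_scaleR[OF manifold open_UNIV assms(3), of "-1"]
    unfolding smooth_near_def by auto
  have "v (\<lambda>q. f q + - 1 * h q) = v f + v (\<lambda>q. - 1 * h q)" "v (\<lambda>q. - 1 * h q) = - 1 * v h"
    using assms(1) near unfolding tangent_space_def by blast+
  then show ?thesis by simp
qed

lemma omega_parallel:
  assumes "Z \<in> vector_fields A" "s \<in> sections A H UNIV" "t \<in> sections A H UNIV"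
  shows "cov_deriv_form Dsum (splitting_omega Hp Hm g) Z s t p = 0"
proof -
  note cs = sections_component[OF open_UNIV assms(2)]
  note ct = sections_component[OF open_UNIV assms(3)]
  let ?sp = "\<lambda>q. cp q (s q)" and ?sm = "\<lambda>q. cm q (s q)"
    and ?tp = "\<lambda>q. cp q (t q)" and ?tm = "\<lambda>q. cm q (t q)"
  have omega: "splitting_omega Hp Hm g q x y = g q (cp q x) (cm q y) - g q (cp q y) (cm q x)"
    if "x \<in> fib H q" "y \<in> fib H q" for q x y
    using omega_sum[of "cp q x" q "cm q x" "cp q y" "cm q y"] that component_mem component_add_eq by simp
  have D: "Dsum Z s \<in> sections A H UNIV" "Dsum Z t \<in> sections A H UNIV"
    using connection_section[OF Dsum_connection assms(1)] assms(2,3) by blast+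
  have st: "s q \<in> fib H q" "t q \<in> fib H q" "Dsum Z s q \<in> fib H q" "Dsum Z t q \<in> fib H q" for q
    using assms(2,3) D by (auto intro: sections_fib)
  \<comment> \<open>Both pairings must be smooth before \<open>Z p\<close> may be distributed over
    their difference.\<close>
  have smooth: "smooth_fun A UNIV (\<lambda>q. g q (?sp q) (?tm q))" "smooth_fun A UNIV (\<lambda>q. g q (?tp q) (?sm q))"
    using form sections_component_H[OF open_UNIV assms(2)] sections_component_H[OF open_UNIV assms(3)]
    by (auto simp: bilinear_bundle_form_def)
  have "Z p \<in> tangent_space A p"
    using sections_fib[OF assms(1)] by (simp add: tangent_bundle_def)
  then have "Z p (\<lambda>q. splitting_omega Hp Hm g q (s q) (t q))
      = Z p (\<lambda>q. g q (?sp q) (?tm q)) - Z p (\<lambda>q. g q (?tp q) (?sm q))"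
    using tangent_diff smooth by (simp add: omega st)
  also have "\<dots> = (g p (Dp Z ?sp p) (?tm p) + g p (?sp p) (Dm Z ?tm p))
      - (g p (Dp Z ?tp p) (?sm p) + g p (?tp p) (Dm Z ?sm p))"
    by (simp only: duality[OF assms(1) cs(1) ct(2)] duality[OF assms(1) ct(1) cs(2)])
  \<comment> \<open>By \<open>component_Dsum\<close>, the first and last of the four terms form
    \<omega>(\<nabla>s, t) and the middle two form \<omega>(s, \<nabla>t).\<close>
  finally show ?thesis
    using fun_cong[OF component_Dsum(1)[OF assms(1,2)]] fun_cong[OF component_Dsum(2)[OF assms(1,2)]]
      fun_cong[OF component_Dsum(1)[OF assms(1,3)]] fun_cong[OF component_Dsum(2)[OF assms(1,3)]]
    by (simp add: cov_deriv_form_def omega st)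
qed

section \<open>Algebraic properties of J and \<omega>, and their smoothness\<close>

lemma J_involution:
  assumes "x \<in> fib H p"
  shows "Jsplit p (Jsplit p x) = x"
proof -
  obtain y a where d: "y \<in> fib Hp p" "a \<in> fib Hm p" "x = y + a" using assms by (rule fib_decompose)
  moreover have "- a \<in> fib Hm p" using subspace_fib(3) d(2) by (rule subspace_neg)
  ultimately show ?thesis using J_sum[of y p a] J_sum[of y p "- a"] by simp
qed

lemma omega_skew:
  assumes "x \<in> fib H p" "y \<in> fib H p"
  shows "splitting_omega Hp Hm g p x y = - splitting_omega Hp Hm g p y x"
proof -
  obtain x1 x2 where x: "x1 \<in> fib Hp p" "x2 \<in> fib Hm p" "x = x1 + x2"
    using assms(1) by (rule fib_decompose)
  obtain y1 y2 where y: "y1 \<in> fib Hp p" "y2 \<in> fib Hm p" "y = y1 + y2"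
    using assms(2) by (rule fib_decompose)
  show ?thesis using x y by (simp add: omega_sum)
qed

text \<open>As J is an involution, \<omega>(Jx, Jy) = g(x, Jy), which by symmetry of
  \<open>g\<close> is \<omega>(y, x); skewness then gives the sign.\<close>

lemma omega_J:
  assumes "x \<in> fib H p" "y \<in> fib H p"
  shows "splitting_omega Hp Hm g p (Jsplit p x) (Jsplit p y) = - splitting_omega Hp Hm g p x y"
proof -
  have "splitting_omega Hp Hm g p (Jsplit p x) (Jsplit p y) = g p x (Jsplit p y)"
    by (simp add: splitting_omega_def J_involution[OF assms(1)])
  also have "\<dots> = splitting_omega Hp Hm g p y x"
    using assms by (simp add: splitting_omega_def form_sym J_mem)
  finally show ?thesis using omega_skew[OF assms(2,1)] by simp
qed

lemma omega_nondegenerate: "nondegenerate H (splitting_omega Hp Hm g)"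
  unfolding nondegenerate_def splitting_omega_def
proof (intro allI ballI impI)
  fix p x assume h: "x \<in> fib H p" "\<forall>y\<in>fib H p. g p (Jsplit p x) y = 0"
  then have "Jsplit p x = 0"
    using form_nondegenerate J_mem[OF h(1)] unfolding nondegenerate_def by blast
  \<comment> \<open>Nondegeneracy of \<open>g\<close> yields only J x = 0. Applying J once more
    leaves J 0, which is 0 because 0 lies in \<open>Hp\<close>, where J is the identity.\<close>
  then have "x = Jsplit p 0" using J_involution[OF h(1)] by simp
  then show "x = 0" using splitting_J_p[of 0 p] subspace_fib(2) by (simp add: subspace_0)
qed

lemma J_bundle_morphism: "bundle_morphism A H H Jsplit"
  using linear_J J_mem sections_J by (auto simp: bundle_morphism_def)

lemma omega_bilinear: "bilinear_bundle_form A H (splitting_omega Hp Hm g)"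
  unfolding bilinear_bundle_form_def splitting_omega_def
proof (intro allI ballI conjI impI)
  fix p x assume x: "x \<in> fib H p"
  show "linear_from (fib H p) (g p (Jsplit p x))"
    using form J_mem[OF x] by (simp add: bilinear_bundle_form_def)
  have "linear_from (fib H p) (\<lambda>y. g p y x)"
    using form x by (simp add: bilinear_bundle_form_def)
  then show "linear_from (fib H p) (\<lambda>y. g p (Jsplit p y) x)"
    using linear_J[of p] J_mem[of _ p] by (simp add: linear_from_def)
next
  fix U s t assume "open U" "s \<in> sections A H U" "t \<in> sections A H U"
  then show "smooth_fun A U (\<lambda>p. g p (Jsplit p (s p)) (t p))"
    using form sections_J by (auto simp: bilinear_bundle_form_def)
qed

end

theorem proposition3:
  fixes A :: "('b::{t2_space,second_countable_topology}, 'n::finite) atlas"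
    and H :: "('b, 'v::real_vector, 'f::euclidean_space) vbundle"
    and Hp :: "('b, 'v, 'g::euclidean_space) vbundle"
    and Hm :: "('b, 'v, 'h::euclidean_space) vbundle"
    and \<tau>p :: "'b \<Rightarrow> 'v \<Rightarrow> 'b tangent"
    and \<tau>m :: "'b \<Rightarrow> 'v \<Rightarrow> ('b tangent \<Rightarrow> real)"
    and g :: "'b \<Rightarrow> 'v \<Rightarrow> 'v \<Rightarrow> real"
    and Dp Dm :: "('b, 'v) conn"
    and \<Psi> :: "'b \<Rightarrow> real"
  assumes "legendre_bundle A H Hp Hm \<tau>p \<tau>m g Dp Dm \<Psi>"
  shows "para_kaehler_bundle A H (splitting_J Hp Hm) (splitting_omega Hp Hm g)
    (sum_connection Hp Hm Dp Dm)"
proof -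
  interpret legendre_bundle A H Hp Hm \<tau>p \<tau>m g Dp Dm \<Psi> by (rule assms)
  show ?thesis
  proof
    \<comment> \<open>The two kernels are the summands \<open>Hp\<close> and \<open>Hm\<close>
      themselves, so equality of ranks is \<open>dim_fib_eq\<close>.\<close>
    show "dim {x \<in> fib H p. Jsplit p x - x = 0} = dim {x \<in> fib H p. Jsplit p x + x = 0}" for p
      by (simp only: J_eigenspaces dim_fib_eq)
  qed (fact manifold vector_bundle_H J_bundle_morphism J_involution omega_bilinear
      omega_nondegenerate omega_skew omega_J Dsum_flat J_parallel omega_parallel)+
qed

end
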